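(* Let $\mathcal{F}=\{F_1,\dots,F_k\}$ be a set of $k$ mutually orthogonal binary frequency squares, each of type $(n;\lambda_0,\lambda_1)$, and let $\mathcal{B}=\{B_{i,j}:1\le i,j\le n\}$ be the collection of blocks derived from $\mathcal{F}$, where $B_{i,j}=\{x\in\{1,\dots,k\}:\text{cell }(i,j)\text{ of }F_x\text{ is }1\}$. Then $(\{1,\dots,k\},\mathcal{B})$ is a $\mathrm{DK}(\lambda_1 n,\lambda_1^2)$-design with $k$ points and $n^2$ blocks. Furthermore, there are two orthogonal equipartitions $\mathcal{P}_1$ and $\mathcal{P}_2$ of $\mathcal{B}$, each of type $n^n$.
   Context: A binary frequency square of type $(n;\lambda_0,\lambda_1)$ (with $\lambda_0,\lambda_1\ge1$, $\lambda_0+\lambda_1=n$) is an $n\times n$ $(0,1)$-matrix with exactly $\lambda_0$ zeros and $\lambda_1$ ones in each row and column; two such squares are orthogonal if exactly $\lambda_1^2$ cells contain $1$ in both. A design is a pair $(\mathcal{V},\mathcal{B})$ with $\mathcal{V}$ a finite set of points and $\mathcal{B}$ a collection (multiset; repeated and empty blocks allowed) of subsets of $\mathcal{V}$. For positive integers $R,\Lambda$, a $\mathrm{DK}(R,\Lambda)$-design (Doehlert–Klee design) is a design in which every pair of distinct points occurs in exactly $\Lambda$ blocks, every point occurs in exactly $R$ blocks, and $R^2=\Lambda|\mathcal{B}|$. A partition of the collection $\mathcal{B}$ (blocks counted with multiplicity) is an equipartition if each point occurs the same number of times among the blocks of each part. Two partitions $\mathcal{P}_1,\mathcal{P}_2$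 of $\mathcal{B}$ are orthogonal if $|P_1\cap P_2|\le 1$ for all $P_1\in\mathcal{P}_1$, $P_2\in\mathcal{P}_2$. A partition has type $n^n$ if it consists of $n$ parts each of cardinality $n$. *)

theory Defs
  imports Main "HOL-Library.Disjoint_Sets"
begin

text \<open>A square is a function whose values matter only on cells
  \<open>(i, j)\<close> with \<open>1 \<le> i, j \<le> n\<close>.\<close>

definition binary_frequency_square ::
    "nat \<Rightarrow> nat \<Rightarrow> nat \<Rightarrow> (nat \<Rightarrow> nat \<Rightarrow> nat) \<Rightarrow> bool" where
  "binary_frequency_square n l0 l1 F \<longleftrightarrow>
     l0 \<ge> 1 \<and> l1 \<ge> 1 \<and> l0 + l1 = n \<and>
     (\<forall>i\<in>{1..n}. \<forall>j\<in>{1..n}. F i j \<in> {0, 1}) \<and>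
     (\<forall>i\<in>{1..n}. card {j \<in> {1..n}. F i j = 0} = l0 \<and> card {j \<in> {1..n}. F i j = 1} = l1) \<and>
     (\<forall>j\<in>{1..n}. card {i \<in> {1..n}. F i j = 0} = l0 \<and> card {i \<in> {1..n}. F i j = 1} = l1)"

definition cells :: "nat \<Rightarrow> (nat \<times> nat) set" where
  "cells n = {1..n} \<times> {1..n}"

definition orthogonal_squares ::
    "nat \<Rightarrow> nat \<Rightarrow> (nat \<Rightarrow> nat \<Rightarrow> nat) \<Rightarrow> (nat \<Rightarrow> nat \<Rightarrow> nat) \<Rightarrow> bool" where
  "orthogonal_squares n l1 F G \<longleftrightarrow>
     card {(i, j) \<in> cells n. F i j = 1 \<and> G i j = 1} = l1\<^sup>2"

text \<open>No injectivity of \<open>F\<close> is required: a square of type \<open>(n; l0, l1)\<close> with \<open>l0 \<ge> 1\<close> is never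
  orthogonal to itself, so the squares are automatically pairwise distinct.\<close>

definition mutually_orthogonal_squares ::
    "nat \<Rightarrow> nat \<Rightarrow> nat \<Rightarrow> nat \<Rightarrow> (nat \<Rightarrow> nat \<Rightarrow> nat \<Rightarrow> nat) \<Rightarrow> bool" where
  "mutually_orthogonal_squares k n l0 l1 F \<longleftrightarrow>
     (\<forall>x\<in>{1..k}. binary_frequency_square n l0 l1 (F x)) \<and>
     (\<forall>x\<in>{1..k}. \<forall>y\<in>{1..k}. x \<noteq> y \<longrightarrow> orthogonal_squares n l1 (F x) (F y))"

text \<open>The block collection of a design is a finite family \<open>B\<close> indexed by \<open>I\<close>: equal blocks with
  different indices are different members of the collection. A partition of the collection is
  therefore a partition of \<open>I\<close>, and intersections of parts count blocks with multiplicity.\<close>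

definition design :: "'p set \<Rightarrow> 'i set \<Rightarrow> ('i \<Rightarrow> 'p set) \<Rightarrow> bool" where
  "design V I B \<longleftrightarrow> finite V \<and> finite I \<and> (\<forall>b\<in>I. B b \<subseteq> V)"

definition DK_design :: "nat \<Rightarrow> nat \<Rightarrow> 'p set \<Rightarrow> 'i set \<Rightarrow> ('i \<Rightarrow> 'p set) \<Rightarrow> bool" where
  "DK_design R L V I B \<longleftrightarrow>
     R > 0 \<and> L > 0 \<and> design V I B \<and>
     (\<forall>x\<in>V. \<forall>y\<in>V. x \<noteq> y \<longrightarrow> card {b \<in> I. x \<in> B b \<and> y \<in> B b} = L) \<and>
     (\<forall>x\<in>V. card {b \<in> I. x \<in> B b} = R) \<and>
     R\<^sup>2 = L * card I"

text \<open>The common number \<open>c\<close> is taken independent of the point. When every point lies in the same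
  number of blocks, as in a DK-design, this agrees with letting \<open>c\<close> depend on the point.\<close>

definition equipartition :: "'p set \<Rightarrow> 'i set \<Rightarrow> ('i \<Rightarrow> 'p set) \<Rightarrow> 'i set set \<Rightarrow> bool" where
  "equipartition V I B P \<longleftrightarrow>
     partition_on I P \<and> (\<exists>c. \<forall>x\<in>V. \<forall>p\<in>P. card {b \<in> p. x \<in> B b} = c)"

definition orthogonal_partitions :: "'i set set \<Rightarrow> 'i set set \<Rightarrow> bool" where
  "orthogonal_partitions P Q \<longleftrightarrow> (\<forall>p\<in>P. \<forall>q\<in>Q. finite (p \<inter> q) \<and> card (p \<inter> q) \<le> 1)"

definition partition_type_pow :: "nat \<Rightarrow> 'i set set \<Rightarrow> bool" where
  "partition_type_pow n P \<longleftrightarrow> finite P \<and> card P = n \<and> (\<forall>p\<in>P. finite p \<and> card p = n)"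

definition derived_block ::
    "nat \<Rightarrow> (nat \<Rightarrow> nat \<Rightarrow> nat \<Rightarrow> nat) \<Rightarrow> nat \<times> nat \<Rightarrow> nat set" where
  "derived_block k F = (\<lambda>(i, j). {x \<in> {1..k}. F x i j = 1})"

end

theory Submission
  imports Defs
begin

text \<open>The two equipartitions group the blocks \<open>B\<^bsub>i,j\<^esub>\<close> by row and by column: a row and a column
  share exactly one cell, and each square has \<open>l1\<close> ones in every row and every column.\<close>

text \<open>Stated on an explicit pair: once \<open>auto\<close> splits an index \<open>b\<close>
  into its coordinates, membership in a block becomes a condition on a single cell.\<close>

lemma mem_derived_block [simp]:
  "x \<in> derived_block k F (i, j) \<longleftrightarrow> x \<in> {1..k} \<and> F x i j = 1"
  by (simp add: derived_block_def)

lemma finite_cells [simp]: "finite (cells n)"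
  by (simp add: cells_def)

lemma card_cells: "card (cells n) = n\<^sup>2"
  by (simp add: cells_def power2_eq_square)

text \<open>Counting row by row: each of the \<open>n\<close> rows contributes \<open>l1\<close>
  ones.\<close>

lemma card_ones_square:
  assumes "binary_frequency_square n l0 l1 F"
  shows "card {(i, j) \<in> cells n. F i j = 1} = l1 * n"
proof -
  have "{(i, j) \<in> cells n. F i j = 1} = (SIGMA i:{1..n}. {j \<in> {1..n}. F i j = 1})"
    by (auto simp: cells_def)
  also have "card \<dots> = (\<Sum>i\<in>{1..n}. card {j \<in> {1..n}. F i j = 1})"
    by (rule card_SigmaI) auto
  also have "\<dots> = (\<Sum>i\<in>{1..n}. l1)"
    using assms by (intro sum.cong) (auto simp: binary_frequency_square_def)
  finally show ?thesis by simp
qed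

text \<open>A block contains \<open>x\<close> exactly when its cell holds a one of
  \<open>F x\<close>. Hence the blocks through \<open>x\<close> are counted by the ones of
  \<open>F x\<close>, and those through two points by the common ones of two squares, which
  orthogonality fixes.\<close>

lemma DK_design_derived_blocks:
  assumes "l0 \<ge> 1" "l1 \<ge> 1" "l0 + l1 = n" and F: "mutually_orthogonal_squares k n l0 l1 F"
  shows "DK_design (l1 * n) (l1\<^sup>2) {1..k} (cells n) (derived_block k F)"
  unfolding DK_design_def
proof (intro conjI ballI impI)
  show "l1 * n > 0" "l1\<^sup>2 > 0"
    using assms by auto
  show "design {1..k} (cells n) (derived_block k F)"
    by (auto simp: design_def derived_block_def)
  show "(l1 * n)\<^sup>2 = l1\<^sup>2 * card (cells n)"
    by (simp add: card_cells power_mult_distrib)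
next
  fix x y assume xy: "x \<in> {1..k}" "y \<in> {1..k}" "x \<noteq> y"
  have "{b \<in> cells n. x \<in> derived_block k F b \<and> y \<in> derived_block k F b}
      = {(i, j) \<in> cells n. F x i j = 1 \<and> F y i j = 1}"
    using xy by auto
  with F xy show "card {b \<in> cells n. x \<in> derived_block k F b \<and> y \<in> derived_block k F b} = l1\<^sup>2"
    by (simp add: mutually_orthogonal_squares_def orthogonal_squares_def)
next
  fix x assume x: "x \<in> {1..k}"
  have "{b \<in> cells n. x \<in> derived_block k F b} = {(i, j) \<in> cells n. F x i j = 1}"
    using x by auto
  moreover have "binary_frequency_square n l0 l1 (F x)"
    using F x by (simp add: mutually_orthogonal_squares_def)
  \<comment> \<open>With \<open>only\<close>, the comprehension keeps the shape that
    \<open>card_ones_square\<close> matches.\<close>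
  ultimately show "card {b \<in> cells n. x \<in> derived_block k F b} = l1 * n"
    by (simp only: card_ones_square)
qed

text \<open>The parts consist of cells, which index the blocks, so equal blocks at different cells
  stay distinct.\<close>

definition row_partition :: "nat \<Rightarrow> (nat \<times> nat) set set" where
  "row_partition n = (\<lambda>i. {i} \<times> {1..n}) ` {1..n}"

definition column_partition :: "nat \<Rightarrow> (nat \<times> nat) set set" where
  "column_partition n = (\<lambda>j. {1..n} \<times> {j}) ` {1..n}"

lemma partition_type_pow_row: "partition_type_pow n (row_partition n)"
  \<comment> \<open>Having \<open>n\<close> parts amounts to injectivity of the indexing: any index
    in \<open>{1..n}\<close> makes that interval nonempty, so the row determines its index.\<close>
  by (auto simp: partition_type_pow_def row_partition_def card_cartesian_product
      intro!: card_image[THEN trans] inj_onI)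

lemma partition_type_pow_column: "partition_type_pow n (column_partition n)"
  by (auto simp: partition_type_pow_def column_partition_def card_cartesian_product
      intro!: card_image[THEN trans] inj_onI)

lemma orthogonal_partitions_row_column:
  "orthogonal_partitions (row_partition n) (column_partition n)"
proof -
  have "({i} \<times> {1..n}) \<inter> ({1..n} \<times> {j}) = {(i, j)}" if "i \<in> {1..n}" "j \<in> {1..n}" for i j
    using that by auto
  then show ?thesis
    by (auto simp: orthogonal_partitions_def row_partition_def column_partition_def)
qed

lemma equipartition_row:
  assumes F: "mutually_orthogonal_squares k n l0 l1 F"
  shows "equipartition {1..k} (cells n) (derived_block k F) (row_partition n)"
proof -
  \<comment> \<open>The common count \<open>c\<close> is \<open>l1\<close>, the number of ones of
    \<open>F x\<close> in row \<open>i\<close>, whatever \<open>x\<close> and \<open>i\<close>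
    are.\<close>
  have "card {b \<in> {i} \<times> {1..n}. x \<in> derived_block k F b} = l1"
    if "x \<in> {1..k}" "i \<in> {1..n}" for x i
  proof -
    have "{b \<in> {i} \<times> {1..n}. x \<in> derived_block k F b} = {i} \<times> {j \<in> {1..n}. F x i j = 1}"
      using that by auto
    with F that show ?thesis
      by (simp add: mutually_orthogonal_squares_def binary_frequency_square_def
          card_cartesian_product)
  qed
  moreover have "partition_on (cells n) (row_partition n)"
    by (auto simp: partition_on_def disjoint_def cells_def row_partition_def)
  ultimately show ?thesis
    unfolding equipartition_def row_partition_def by blast
qed

text \<open>The count is again \<open>l1\<close>, this time from the column clause of
  \<open>binary_frequency_square\<close>.\<close>

lemma equipartition_column:
  assumes F: "mutually_orthogonal_squares k n l0 l1 F"
  shows "equipartition {1..k} (cells n) (derived_block k F) (column_partition n)"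
proof -
  have "card {b \<in> {1..n} \<times> {j}. x \<in> derived_block k F b} = l1"
    if "x \<in> {1..k}" "j \<in> {1..n}" for x j
  proof -
    have "{b \<in> {1..n} \<times> {j}. x \<in> derived_block k F b} = {i \<in> {1..n}. F x i j = 1} \<times> {j}"
      using that by auto
    with F that show ?thesis
      by (simp add: mutually_orthogonal_squares_def binary_frequency_square_def
          card_cartesian_product)
  qed
  moreover have "partition_on (cells n) (column_partition n)"
    by (auto simp: partition_on_def disjoint_def cells_def column_partition_def)
  ultimately show ?thesis
    unfolding equipartition_def column_partition_def by blast
qed

theorem theorem3p2:
  fixes k n l0 l1 :: nat and F :: "nat \<Rightarrow> nat \<Rightarrow> nat \<Rightarrow> nat"
  assumes "l0 \<ge> 1" and "l1 \<ge> 1" and "l0 + l1 = n"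
    and "mutually_orthogonal_squares k n l0 l1 F"
  shows "DK_design (l1 * n) (l1\<^sup>2) {1..k} (cells n) (derived_block k F)
    \<and> card {1..k} = k \<and> card (cells n) = n\<^sup>2
    \<and> (\<exists>P1 P2.
          equipartition {1..k} (cells n) (derived_block k F) P1
        \<and> equipartition {1..k} (cells n) (derived_block k F) P2
        \<and> partition_type_pow n P1 \<and> partition_type_pow n P2
        \<and> orthogonal_partitions P1 P2)"
proof (intro conjI)
  show "DK_design (l1 * n) (l1\<^sup>2) {1..k} (cells n) (derived_block k F)"
    using assms by (rule DK_design_derived_blocks)
  show "card {1..k} = k" by simp
  show "card (cells n) = n\<^sup>2" by (rule card_cells)
  show "\<exists>P1 P2.
          equipartition {1..k} (cells n) (derived_block k F) P1
        \<and> equipartition {1..k} (cells n) (derived_block k F) P2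
        \<and> partition_type_pow n P1 \<and> partition_type_pow n P2
        \<and> orthogonal_partitions P1 P2"
    \<comment> \<open>The witnesses are \<open>row_partition n\<close> for \<open>P1\<close> and
      \<open>column_partition n\<close> for \<open>P2\<close>.\<close>
    using equipartition_row[OF assms(4)] equipartition_column[OF assms(4)]
      partition_type_pow_row partition_type_pow_column orthogonal_partitions_row_column
    by blast
qed

end
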